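(* Suppose $0<\alpha\le 1$ and $m\ge 0$. Let $$q_1=-n+\sqrt{n^2+\alpha m^2}.$$ Then for $q<q_1$ the global minimizer of the constrained variational problem $(P_0)$ is (up to equality almost everywhere) the constant state $$\mathbf u=\left(\sqrt{\frac{n+m}{2}},\,0,\,\sqrt{\frac{n-m}{2}}\right).$$
   Context: $\Omega\subset\mathbb R^3$ is a bounded domain with smooth boundary, $|\cdot|$ denotes Lebesgue measure, and $\mathbb R_+=[0,\infty)$. Real numbers $\alpha$, $q$, $N>0$, $M$ are given with $0\le M\le N$; put $n=N/|\Omega|$ and $m=M/|\Omega|$. A vector is written $\mathbf u=(u_1,u_0,u_{-1})\in\mathbb R_+^3$. The Thomas-Fermi Hamiltonian is $$H_{TF}(\mathbf u)=\tfrac12(u_1^2+u_0^2+u_{-1}^2)^2+\tfrac{\alpha}{2}\left[2u_0^2(u_1-\mathrm{sgn}(\alpha)u_{-1})^2+(u_1^2-u_{-1}^2)^2\right]+q(u_1^2+u_{-1}^2).$$ Problem $(P_0)$: minimize $\int_\Omega H_{TF}(\mathbf u(x))\,dx$ over all $\mathbf u\in (L^2(\Omega,\mathbb R_+))^3$ subject to $\int_\Omega (u_1^2+u_0^2+u_{-1}^2)\,dx=N$ and $\int_\Omega (u_1^2-u_{-1}^2)\,dx=M$. *)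

theory Defs
  imports "HOL-Analysis.Analysis"
begin

text \<open>\<open>Ck_on k f S\<close>, for open \<open>S\<close>: the function \<open>f\<close> is of class \<open>C\<^sup>k\<close> on \<open>S\<close>; \<open>D i\<close> is
  its partial derivative in the direction of the basis vector \<open>i\<close>.\<close>

primrec Ck_on :: "nat \<Rightarrow> ('a::euclidean_space \<Rightarrow> real) \<Rightarrow> 'a set \<Rightarrow> bool" where
  "Ck_on 0 f S \<longleftrightarrow> continuous_on S f"
| "Ck_on (Suc k) f S \<longleftrightarrow>
     (\<exists>D. (\<forall>x\<in>S. (f has_derivative (\<lambda>h. \<Sum>i\<in>Basis. (h \<bullet> i) * D i x)) (at x)) \<and>
          (\<forall>i\<in>Basis. Ck_on k (D i) S))"

text \<open>Near each boundary point, \<open>\<Omega>\<close> is the sublevel set, and its boundary the zero set, of a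
  \<open>C\<^sup>\<infinity>\<close> function with nowhere vanishing gradient.\<close>

definition smooth_boundary :: "('a::euclidean_space) set \<Rightarrow> bool" where
  "smooth_boundary \<Omega> \<longleftrightarrow>
     (\<forall>p\<in>frontier \<Omega>. \<exists>V \<phi>. open V \<and> p \<in> V \<and> (\<forall>k. Ck_on k \<phi> V) \<and>
        (\<forall>x\<in>V. \<not> (\<phi> has_derivative (\<lambda>h. 0)) (at x)) \<and>
        \<Omega> \<inter> V = {x \<in> V. \<phi> x < 0} \<and>
        frontier \<Omega> \<inter> V = {x \<in> V. \<phi> x = 0})"

definition bounded_smooth_domain :: "('a::euclidean_space) set \<Rightarrow> bool" where
  "bounded_smooth_domain \<Omega> \<longleftrightarrow>
     open \<Omega> \<and> connected \<Omega> \<and> \<Omega> \<noteq> {} \<and> bounded \<Omega> \<and> smooth_boundary \<Omega>"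

text \<open>Triples are ordered as \<open>(u\<^sub>1, u\<^sub>0, u\<^sub>-\<^sub>1)\<close>; \<open>um\<close> stands for \<open>u\<^sub>-\<^sub>1\<close>.\<close>

definition H_TF :: "real \<Rightarrow> real \<Rightarrow> real \<times> real \<times> real \<Rightarrow> real" where
  "H_TF \<alpha> q = (\<lambda>(u1, u0, um).
     1/2 * (u1\<^sup>2 + u0\<^sup>2 + um\<^sup>2)\<^sup>2
     + \<alpha>/2 * (2 * u0\<^sup>2 * (u1 - sgn \<alpha> * um)\<^sup>2 + (u1\<^sup>2 - um\<^sup>2)\<^sup>2)
     + q * (u1\<^sup>2 + um\<^sup>2))"

text \<open>Lebesgue integral with values in the extended reals. The Bochner integral of a function
  that is not integrable is \<open>0\<close>, so it cannot serve as the energy: \<open>H_TF\<close> is quartic, and the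
  energy of an \<open>L\<^sup>2\<close> state that is not in \<open>L\<^sup>4\<close> is \<open>\<infinity>\<close>. The negative part of \<open>H_TF\<close>
  along a state in \<open>L\<^sup>2\<close> has finite integral when \<open>\<alpha> \<ge> 0\<close>, so \<open>\<infinity> - \<infinity>\<close> does not then occur.\<close>

definition ext_integral :: "'a measure \<Rightarrow> ('a \<Rightarrow> real) \<Rightarrow> ereal" where
  "ext_integral \<mu> f =
     enn2ereal (\<integral>\<^sup>+x. ennreal (f x) \<partial>\<mu>) - enn2ereal (\<integral>\<^sup>+x. ennreal (- f x) \<partial>\<mu>)"

definition energy ::
    "real \<Rightarrow> real \<Rightarrow> 'a::euclidean_space set \<Rightarrow> ('a \<Rightarrow> real \<times> real \<times> real) \<Rightarrow> ereal" where
  "energy \<alpha> q \<Omega> u = ext_integral (lebesgue_on \<Omega>) (\<lambda>x. H_TF \<alpha> q (u x))"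

text \<open>Representatives of the elements of \<open>L\<^sup>2(\<Omega>, [0,\<infinity>))\<close>.\<close>

definition L2_nonneg :: "'a::euclidean_space set \<Rightarrow> ('a \<Rightarrow> real) set" where
  "L2_nonneg \<Omega> = {f \<in> borel_measurable (lebesgue_on \<Omega>).
     (AE x in lebesgue_on \<Omega>. 0 \<le> f x) \<and> integrable (lebesgue_on \<Omega>) (\<lambda>x. (f x)\<^sup>2)}"

definition admissible ::
    "'a::euclidean_space set \<Rightarrow> real \<Rightarrow> real \<Rightarrow> ('a \<Rightarrow> real \<times> real \<times> real) \<Rightarrow> bool" where
  "admissible \<Omega> N M u \<longleftrightarrow>
     (\<exists>u1\<in>L2_nonneg \<Omega>. \<exists>u0\<in>L2_nonneg \<Omega>. \<exists>um\<in>L2_nonneg \<Omega>.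
        u = (\<lambda>x. (u1 x, u0 x, um x)) \<and>
        (\<integral>x. (u1 x)\<^sup>2 + (u0 x)\<^sup>2 + (um x)\<^sup>2 \<partial>lebesgue_on \<Omega>) = N \<and>
        (\<integral>x. (u1 x)\<^sup>2 - (um x)\<^sup>2 \<partial>lebesgue_on \<Omega>) = M)"

text \<open>Solutions of problem \<open>(P\<^sub>0)\<close>.\<close>

definition global_minimizer ::
    "real \<Rightarrow> real \<Rightarrow> 'a::euclidean_space set \<Rightarrow> real \<Rightarrow> real \<Rightarrow> ('a \<Rightarrow> real \<times> real \<times> real) \<Rightarrow> bool" where
  "global_minimizer \<alpha> q \<Omega> N M u \<longleftrightarrow>
     admissible \<Omega> N M u \<and> (\<forall>v. admissible \<Omega> N M v \<longrightarrow> energy \<alpha> q \<Omega> u \<le> energy \<alpha> q \<Omega> v)"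

end

theory Submission imports Defs begin

text \<open>Put \<open>s = u\<^sub>1\<^sup>2 + u\<^sub>0\<^sup>2 + u\<^sub>-\<^sub>1\<^sup>2\<close> and \<open>d = u\<^sub>1\<^sup>2 - u\<^sub>-\<^sub>1\<^sup>2\<close>. The function that is affine in \<open>(s, d)\<close>
  and tangent at \<open>(n, m)\<close> to \<open>H_TF\<close> restricted to \<open>u\<^sub>0 = 0\<close> lies below \<open>H_TF\<close> everywhere and
  touches it on nonnegative triples only at the constant state. Its integral is the same for all
  admissible states, so integrating the inequality proves minimality, and the equality case gives
  uniqueness.\<close>

definition H_TF_tangent :: "real \<Rightarrow> real \<Rightarrow> real \<Rightarrow> real \<Rightarrow> real \<times> real \<times> real \<Rightarrow> real" where
  "H_TF_tangent \<alpha> q n m = (\<lambda>(x, z, y).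
     n\<^sup>2 / 2 + \<alpha> * m\<^sup>2 / 2 + q * n
     + (n + q) * (x\<^sup>2 + z\<^sup>2 + y\<^sup>2 - n) + \<alpha> * m * (x\<^sup>2 - y\<^sup>2 - m))"

section \<open>Pointwise gap between the energy density and its tangent\<close>

text \<open>Since \<open>x\<^sup>2 + y\<^sup>2 = s - z\<^sup>2\<close>, the density is quadratic in
  \<open>(s, d)\<close> apart from terms with the factor \<open>z\<^sup>2\<close>. Subtracting the
  tangent leaves the second-order remainders, and only the sign of the coefficient of
  \<open>z\<^sup>2\<close> is in doubt.\<close>

lemma H_TF_minus_tangent:
  assumes "\<alpha> > 0"
  shows "H_TF \<alpha> q (x, z, y) - H_TF_tangent \<alpha> q n m (x, z, y) =
    (x\<^sup>2 + z\<^sup>2 + y\<^sup>2 - n)\<^sup>2 / 2 + \<alpha> * (x\<^sup>2 - y\<^sup>2 - m)\<^sup>2 / 2 + z\<^sup>2 * (\<alpha> * (x - y)\<^sup>2 - q)"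
proof -
  let ?s = "x\<^sup>2 + z\<^sup>2 + y\<^sup>2" and ?d = "x\<^sup>2 - y\<^sup>2"
  have *: "1/2 * s\<^sup>2 + \<alpha>/2 * (2 * z\<^sup>2 * w\<^sup>2 + d\<^sup>2) + q * (s - z\<^sup>2)
      - (n\<^sup>2 / 2 + \<alpha> * m\<^sup>2 / 2 + q * n + (n + q) * (s - n) + \<alpha> * m * (d - m))
    = (s - n)\<^sup>2 / 2 + \<alpha> * (d - m)\<^sup>2 / 2 + z\<^sup>2 * (\<alpha> * w\<^sup>2 - q)" for s d w :: real
    by (simp add: field_simps power2_eq_square)
  have "x\<^sup>2 + y\<^sup>2 = ?s - z\<^sup>2"
    by simp
  then show ?thesis
    using *[of ?s "x - y" ?d] assms unfolding H_TF_def H_TF_tangent_def by simp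
qed

text \<open>The case in which the term in \<open>u\<^sub>0\<^sup>2\<close> is negative: complete the square first in \<open>s\<close>, then in
  \<open>u\<^sub>1 + u\<^sub>-\<^sub>1\<close>.\<close>

lemma H_TF_minus_tangent_squares:
  assumes "\<alpha> > 0" "q \<noteq> 0" and e: "e = q - \<alpha> * (x - y)\<^sup>2"
  shows "H_TF \<alpha> q (x, z, y) - H_TF_tangent \<alpha> q n m (x, z, y) =
    (x\<^sup>2 + z\<^sup>2 + y\<^sup>2 - n - e)\<^sup>2 / 2 + (q * (x + y) - \<alpha> * m * (x - y))\<^sup>2 / (2 * q)
    + e / (2 * q) * (\<alpha> * m\<^sup>2 - 2 * n * q - q\<^sup>2 + q * (1 + \<alpha>) * (x - y)\<^sup>2)"
proof -
  let ?s = "x\<^sup>2 + z\<^sup>2 + y\<^sup>2"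
  have divide: "A = B + a / (2 * q) + b / (2 * q)" if "2 * q * A = 2 * q * B + a + b" for A B a b
    using that \<open>q \<noteq> 0\<close> by (simp add: field_simps)
  \<comment> \<open>The claim with the common term \<open>(?s - n)\<^sup>2 / 2\<close> cancelled and
    the denominators \<open>2 * q\<close> cleared: a polynomial identity once \<open>e\<close> is
    expanded.\<close>
  have "2 * q * (\<alpha> * (x\<^sup>2 - y\<^sup>2 - m)\<^sup>2 / 2 - z\<^sup>2 * e) =
      2 * q * (e\<^sup>2 / 2 - (?s - n) * e) + (q * (x + y) - \<alpha> * m * (x - y))\<^sup>2
      + e * (\<alpha> * m\<^sup>2 - 2 * n * q - q\<^sup>2 + q * (1 + \<alpha>) * (x - y)\<^sup>2)"
    (is "_ = _ + ?a + ?b")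
    using e by algebra
  then have "\<alpha> * (x\<^sup>2 - y\<^sup>2 - m)\<^sup>2 / 2 - z\<^sup>2 * e = e\<^sup>2 / 2 - (?s - n) * e + ?a / (2 * q) + ?b / (2 * q)"
    by (rule divide)
  moreover have "(?s - n - e)\<^sup>2 / 2 = (?s - n)\<^sup>2 / 2 + e\<^sup>2 / 2 - (?s - n) * e"
    by (simp add: power2_eq_square field_simps)
  moreover have "z\<^sup>2 * (\<alpha> * (x - y)\<^sup>2 - q) = - (z\<^sup>2 * e)"
    unfolding e by (simp add: algebra_simps)
  ultimately show ?thesis
    unfolding H_TF_minus_tangent[OF \<open>\<alpha> > 0\<close>] times_divide_eq_left by linarith
qed

text \<open>The bound on \<open>q\<close> is the larger root of
  \<open>t\<^sup>2 + 2 * n * t - \<alpha> * m\<^sup>2\<close>; for \<open>q > 0\<close> the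
  inequality \<open>n + q < sqrt ...\<close> can be squared.\<close>

lemma quadratic_pos_of_less_q1:
  fixes n m \<alpha> q :: real
  assumes "n > 0" "0 < q" "q < - n + sqrt (n\<^sup>2 + \<alpha> * m\<^sup>2)"
  shows "\<alpha> * m\<^sup>2 - 2 * n * q - q\<^sup>2 > 0"
proof -
  have "n + q < sqrt (n\<^sup>2 + \<alpha> * m\<^sup>2)"
    using assms by simp
  then have "(n + q)\<^sup>2 < n\<^sup>2 + \<alpha> * m\<^sup>2"
    using assms by (metis not_less real_sqrt_le_iff real_sqrt_unique add_pos_pos less_imp_le)
  then show ?thesis
    by (simp add: power2_sum algebra_simps)
qed

text \<open>The sign of \<open>\<alpha> * (x - y)\<^sup>2 - q\<close> decides. If it is negative,
  the completed squares give a strictly positive gap, so no contact occurs; otherwise the gap is a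
  sum of three nonnegative terms, which must all vanish at contact.\<close>

lemma H_TF_tangent_le_and_eq:
  assumes \<alpha>: "\<alpha> > 0" and n: "n > 0" and q: "q < - n + sqrt (n\<^sup>2 + \<alpha> * m\<^sup>2)"
  shows "H_TF_tangent \<alpha> q n m (x, z, y) \<le> H_TF \<alpha> q (x, z, y) \<and>
    (H_TF_tangent \<alpha> q n m (x, z, y) = H_TF \<alpha> q (x, z, y) \<longrightarrow>
       z = 0 \<and> x\<^sup>2 + y\<^sup>2 = n \<and> x\<^sup>2 - y\<^sup>2 = m)"
proof (cases "\<alpha> * (x - y)\<^sup>2 < q")
  case True
  define e where "e = q - \<alpha> * (x - y)\<^sup>2"
  have "0 \<le> \<alpha> * (x - y)\<^sup>2"
    using \<alpha> by simp
  then have "q > 0"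
    using True by linarith
  have "e > 0"
    using True by (simp add: e_def)
  have "0 \<le> q * (1 + \<alpha>) * (x - y)\<^sup>2"
    using \<alpha> \<open>q > 0\<close> by simp
  \<comment> \<open>This summand alone makes the gap strict.\<close>
  then have "e / (2 * q) * (\<alpha> * m\<^sup>2 - 2 * n * q - q\<^sup>2 + q * (1 + \<alpha>) * (x - y)\<^sup>2) > 0"
    using quadratic_pos_of_less_q1[OF n \<open>q > 0\<close> q] \<open>q > 0\<close> \<open>e > 0\<close>
    by (intro mult_pos_pos divide_pos_pos) linarith+
  moreover have "(q * (x + y) - \<alpha> * m * (x - y))\<^sup>2 / (2 * q) \<ge> 0"
    using \<open>q > 0\<close> by simp
  moreover have "(x\<^sup>2 + z\<^sup>2 + y\<^sup>2 - n - e)\<^sup>2 / 2 \<ge> 0"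
    by simp
  ultimately have "H_TF \<alpha> q (x, z, y) - H_TF_tangent \<alpha> q n m (x, z, y) > 0"
    using H_TF_minus_tangent_squares[OF \<alpha> _ e_def, of z n m] \<open>q > 0\<close> by linarith
  then show ?thesis
    by simp
next
  case False
  let ?s = "x\<^sup>2 + z\<^sup>2 + y\<^sup>2 - n" and ?d = "x\<^sup>2 - y\<^sup>2 - m" and ?r = "z\<^sup>2 * (\<alpha> * (x - y)\<^sup>2 - q)"
  note diff = H_TF_minus_tangent[OF \<alpha>, of q x z y n m]
  have s: "?s\<^sup>2 / 2 \<ge> 0" and d: "\<alpha> * ?d\<^sup>2 / 2 \<ge> 0" and r: "?r \<ge> 0"
    using \<alpha> False by auto
  have "z = 0 \<and> ?s = 0 \<and> ?d = 0" if "H_TF_tangent \<alpha> q n m (x, z, y) = H_TF \<alpha> q (x, z, y)"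
  proof -
    have "?s\<^sup>2 / 2 = 0" "\<alpha> * ?d\<^sup>2 / 2 = 0" "?r = 0"
      using that diff s d r by linarith+
    then have sd: "?s = 0" "?d = 0" and "z = 0 \<or> q = \<alpha> * (x - y)\<^sup>2"
      using \<alpha> by auto
    \<comment> \<open>In this borderline case the term in \<open>z\<^sup>2\<close> vanishes
      identically and says nothing about \<open>z\<close>; the bound on \<open>q\<close> has to
      settle it.\<close>
    moreover have "z = 0" if qe: "q = \<alpha> * (x - y)\<^sup>2"
    proof (cases "x = y")
      case True
      then have "m = 0" "q = 0"
        using sd qe by auto
      then show ?thesis
        using q n by simp
    next
      case xy: False
      then have "q > 0"
        using qe \<alpha> by simp
      have m: "m = (x - y) * (x + y)"
        using sd by (simp add: power2_eq_square algebra_simps)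
      have "\<alpha> * m\<^sup>2 = q * (x + y)\<^sup>2"
        unfolding m qe by (simp add: power_mult_distrib)
      \<comment> \<open>Substituting \<open>\<alpha> * m\<^sup>2\<close> into the quadratic
        inequality forces \<open>x\<^sup>2 + y\<^sup>2 > n\<close>, whereas \<open>?s = 0\<close>
        gives \<open>x\<^sup>2 + y\<^sup>2 = n - z\<^sup>2\<close>.\<close>
      then have "0 < q * ((x + y)\<^sup>2 - 2 * n - q)"
        using quadratic_pos_of_less_q1[OF n \<open>q > 0\<close> q] by (simp add: power2_eq_square algebra_simps)
      then have "2 * n < (x + y)\<^sup>2"
        using \<open>q > 0\<close> by (simp add: zero_less_mult_iff)
      also have "\<dots> \<le> 2 * x\<^sup>2 + 2 * y\<^sup>2"
        using zero_le_power2[of "x - y"] by (simp add: power2_eq_square algebra_simps)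
      finally have "z\<^sup>2 < 0"
        using sd by linarith
      then show ?thesis
        by simp
    qed
    ultimately show ?thesis
      by blast
  qed
  moreover have "H_TF_tangent \<alpha> q n m (x, z, y) \<le> H_TF \<alpha> q (x, z, y)"
    using diff s d r by linarith
  ultimately show ?thesis
    by auto
qed

section \<open>Extended integrals of functions with an integrable minorant\<close>

lemma ext_integral_integrable:
  assumes "integrable M f"
  shows "ext_integral M f = ereal (\<integral>x. f x \<partial>M)"
proof -
  have "(\<integral>\<^sup>+x. ennreal (f x) \<partial>M) \<noteq> \<infinity>" "(\<integral>\<^sup>+x. ennreal (- f x) \<partial>M) \<noteq> \<infinity>"
    using assms by (auto simp: real_integrable_def)
  then obtain a b where "a \<ge> 0" "(\<integral>\<^sup>+x. ennreal (f x) \<partial>M) = ennreal a"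
    and "b \<ge> 0" "(\<integral>\<^sup>+x. ennreal (- f x) \<partial>M) = ennreal b"
    by (metis ennreal_cases infinity_ennreal_def)
  then show ?thesis
    unfolding ext_integral_def real_lebesgue_integral_def[OF assms]
    by (simp add: enn2ereal_ennreal)
qed

text \<open>The minorant \<open>g\<close> bounds the negative part, so integrability can fail only
  through an infinite positive part.\<close>

lemma ext_integral_not_integrable:
  assumes f: "f \<in> borel_measurable M" "\<not> integrable M f"
    and g: "integrable M g" and le: "\<And>x. g x \<le> f x"
  shows "ext_integral M f = \<infinity>"
proof -
  have "(\<integral>\<^sup>+x. ennreal (- f x) \<partial>M) \<le> (\<integral>\<^sup>+x. ennreal (- g x) \<partial>M)"
    by (intro nn_integral_mono ennreal_leI) (simp add: le)
  also have "\<dots> < \<infinity>"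
    using g by (simp add: real_integrable_def top.not_eq_extremum)
  finally have neg: "(\<integral>\<^sup>+x. ennreal (- f x) \<partial>M) \<noteq> \<infinity>"
    by simp
  then have "(\<integral>\<^sup>+x. ennreal (f x) \<partial>M) = \<infinity>"
    using f by (auto simp: real_integrable_def)
  then show ?thesis
    unfolding ext_integral_def using neg by simp
qed

lemma ext_integral_ge:
  assumes f: "f \<in> borel_measurable M" and g: "integrable M g" and le: "\<And>x. g x \<le> f x"
  shows "ereal (\<integral>x. g x \<partial>M) \<le> ext_integral M f"
proof (cases "integrable M f")
  case True
  then show ?thesis
    using integral_mono[OF g True le] by (simp add: ext_integral_integrable)
next
  case False
  then show ?thesis
    using ext_integral_not_integrable[OF f False g le] by simp
qed

text \<open>A finite upper bound excludes the value \<open>\<infinity>\<close>, so \<open>f\<close>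
  is integrable; then \<open>f - g\<close> is nonnegative with integral zero.\<close>

lemma ext_integral_le_imp_AE_eq:
  assumes f: "f \<in> borel_measurable M" and g: "integrable M g" and le: "\<And>x. g x \<le> f x"
    and ext: "ext_integral M f \<le> ereal (\<integral>x. g x \<partial>M)"
  shows "AE x in M. g x = f x"
proof -
  have int: "integrable M f"
    using ext_integral_not_integrable[OF f _ g le] ext by fastforce
  then have "(\<integral>x. f x - g x \<partial>M) = 0"
    using ext g integral_mono[OF g int le] by (simp add: ext_integral_integrable)
  moreover have "integrable M (\<lambda>x. f x - g x)"
    using int g by simp
  ultimately have "AE x in M. f x - g x = 0"
    using integral_nonneg_eq_0_iff_AE[of M "\<lambda>x. f x - g x"] le by simp
  then show ?thesis
    by (rule AE_mp) simp
qed

section \<open>The tangent along admissible states\<close>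

lemma borel_measurable_H_TF:
  assumes [measurable]: "u1 \<in> borel_measurable M" "u0 \<in> borel_measurable M" "um \<in> borel_measurable M"
  shows "(\<lambda>x. H_TF \<alpha> q (u1 x, u0 x, um x)) \<in> borel_measurable M"
  unfolding H_TF_def by simp

lemma admissible_tangent:
  fixes \<Omega> :: "'a::euclidean_space set" and \<alpha> q N M n m :: real
  assumes \<Omega>: "\<Omega> \<in> lmeasurable" "measure lebesgue \<Omega> > 0"
    and n: "n = N / measure lebesgue \<Omega>" and m: "m = M / measure lebesgue \<Omega>"
    and u: "admissible \<Omega> N M u"
  shows "(\<lambda>x. H_TF \<alpha> q (u x)) \<in> borel_measurable (lebesgue_on \<Omega>)" (is ?meas)
    and "integrable (lebesgue_on \<Omega>) (\<lambda>x. H_TF_tangent \<alpha> q n m (u x))" (is ?int)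
    and "(\<integral>x. H_TF_tangent \<alpha> q n m (u x) \<partial>lebesgue_on \<Omega>) =
      measure lebesgue \<Omega> * (n\<^sup>2 / 2 + \<alpha> * m\<^sup>2 / 2 + q * n)" (is ?val)
    and "AE x in lebesgue_on \<Omega>. 0 \<le> fst (u x) \<and> 0 \<le> snd (snd (u x))" (is ?nonneg)
proof -
  let ?L = "lebesgue_on \<Omega>"
  obtain u1 u0 um where uu: "u1 \<in> L2_nonneg \<Omega>" "u0 \<in> L2_nonneg \<Omega>" "um \<in> L2_nonneg \<Omega>"
    and ueq: "u = (\<lambda>x. (u1 x, u0 x, um x))"
    and N: "(\<integral>x. (u1 x)\<^sup>2 + (u0 x)\<^sup>2 + (um x)\<^sup>2 \<partial>?L) = N"
    and M: "(\<integral>x. (u1 x)\<^sup>2 - (um x)\<^sup>2 \<partial>?L) = M"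
    using u unfolding admissible_def by blast
  show ?meas
    using uu unfolding ueq L2_nonneg_def by (intro borel_measurable_H_TF) auto
  show ?nonneg
    using uu unfolding ueq L2_nonneg_def by auto
  interpret finite_measure ?L
    using \<Omega>(1) by (rule finite_measure_lebesgue_on)
  have sq: "integrable ?L (\<lambda>x. (u1 x)\<^sup>2)" "integrable ?L (\<lambda>x. (u0 x)\<^sup>2)" "integrable ?L (\<lambda>x. (um x)\<^sup>2)"
    using uu unfolding L2_nonneg_def by auto
  have meas: "measure ?L \<Omega> = measure lebesgue \<Omega>"
    using \<Omega>(1) by (simp add: measure_restrict_space fmeasurableD)
  \<comment> \<open>By the choice of \<open>n\<close> and \<open>m\<close> as averages, the two
    constraints say that \<open>s - n\<close> and \<open>d - m\<close> have mean zero; hence only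
    the constant part of the tangent survives integration.\<close>
  have s: "integrable ?L (\<lambda>x. (u1 x)\<^sup>2 + (u0 x)\<^sup>2 + (um x)\<^sup>2 - n)"
    "(\<integral>x. (u1 x)\<^sup>2 + (u0 x)\<^sup>2 + (um x)\<^sup>2 - n \<partial>?L) = 0"
    using sq N \<Omega>(2) by (simp_all add: meas n)
  have d: "integrable ?L (\<lambda>x. (u1 x)\<^sup>2 - (um x)\<^sup>2 - m)"
    "(\<integral>x. (u1 x)\<^sup>2 - (um x)\<^sup>2 - m \<partial>?L) = 0"
    using sq M \<Omega>(2) by (simp_all add: meas m)
  show ?int
    unfolding ueq H_TF_tangent_def using s(1) d(1)
    by (simp del: Bochner_Integration.integrable_diff)
  show ?val
    unfolding ueq H_TF_tangent_def
    by (simp add: s d meas del: Bochner_Integration.integral_diff)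
qed

section \<open>Minimality and uniqueness of the constant state\<close>

theorem theorem3p2:
  fixes \<Omega> :: "(real^3) set" and \<alpha> q N M n m q1 :: real
  assumes "bounded_smooth_domain \<Omega>"
    and "N > 0" and "0 \<le> M" and "M \<le> N"
    and "n = N / measure lebesgue \<Omega>" and "m = M / measure lebesgue \<Omega>"
    and "0 < \<alpha>" and "\<alpha> \<le> 1" and "m \<ge> 0"
    and "q1 = - n + sqrt (n\<^sup>2 + \<alpha> * m\<^sup>2)"
    and "q < q1"
  shows "global_minimizer \<alpha> q \<Omega> N M (\<lambda>x. (sqrt ((n + m) / 2), 0, sqrt ((n - m) / 2))) \<and>
    (\<forall>u. global_minimizer \<alpha> q \<Omega> N M u \<longrightarrow>
       (AE x in lebesgue_on \<Omega>. u x = (sqrt ((n + m) / 2), 0, sqrt ((n - m) / 2))))"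
proof -
  let ?L = "lebesgue_on \<Omega>"
  let ?c = "(sqrt ((n + m) / 2), 0, sqrt ((n - m) / 2)) :: real \<times> real \<times> real"
  let ?E = "measure lebesgue \<Omega> * (n\<^sup>2 / 2 + \<alpha> * m\<^sup>2 / 2 + q * n)"
  have \<Omega>: "open \<Omega>" "bounded \<Omega>" "\<Omega> \<noteq> {}"
    using assms(1) by (auto simp: bounded_smooth_domain_def)
  then have lm: "\<Omega> \<in> lmeasurable"
    by (simp add: lmeasurable_open)
  have pos: "measure lebesgue \<Omega> > 0"
    using \<Omega> lm open_not_negligible[of \<Omega>] by (simp add: negligible_iff_measure zero_less_measure_iff)
  have n: "n > 0"
    using assms pos by simp
  have mn: "m \<le> n"
    using assms pos by (simp add: divide_right_mono)
  interpret finite_measure ?L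
    using lm by (rule finite_measure_lebesgue_on)
  have meas: "measure ?L \<Omega> = measure lebesgue \<Omega>"
    using lm by (simp add: measure_restrict_space fmeasurableD)
  \<comment> \<open>The components solve \<open>x\<^sup>2 + y\<^sup>2 = n\<close> and
    \<open>x\<^sup>2 - y\<^sup>2 = m\<close>; \<open>0 \<le> m \<le> n\<close> makes both radicands
    nonnegative.\<close>
  have c: "(sqrt ((n + m) / 2))\<^sup>2 = (n + m) / 2" "(sqrt ((n - m) / 2))\<^sup>2 = (n - m) / 2"
    using n mn \<open>m \<ge> 0\<close> by simp_all
  have adm: "admissible \<Omega> N M (\<lambda>x. ?c)"
  proof -
    have "(\<lambda>x. sqrt ((n + m) / 2)) \<in> L2_nonneg \<Omega>" "(\<lambda>x. 0) \<in> L2_nonneg \<Omega>"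
      "(\<lambda>x. sqrt ((n - m) / 2)) \<in> L2_nonneg \<Omega>"
      using n mn \<open>m \<ge> 0\<close> by (auto simp: L2_nonneg_def)
    moreover have "(\<integral>x. (sqrt ((n + m) / 2))\<^sup>2 + 0\<^sup>2 + (sqrt ((n - m) / 2))\<^sup>2 \<partial>?L) = N"
      "(\<integral>x. (sqrt ((n + m) / 2))\<^sup>2 - (sqrt ((n - m) / 2))\<^sup>2 \<partial>?L) = M"
      unfolding c using pos assms(5,6) by (simp_all add: meas field_simps)
    ultimately show ?thesis
      unfolding admissible_def
      by (intro bexI[of _ "\<lambda>x. sqrt ((n + m) / 2)"] bexI[of _ "\<lambda>x. 0"]
          bexI[of _ "\<lambda>x. sqrt ((n - m) / 2)"] conjI refl)
  qed
  have Hc: "H_TF \<alpha> q ?c = n\<^sup>2 / 2 + \<alpha> * m\<^sup>2 / 2 + q * n"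
  proof -
    have "(n + m) / 2 + (n - m) / 2 = n" "(n + m) / 2 - (n - m) / 2 = m"
      by (simp_all add: field_simps)
    then show ?thesis
      unfolding H_TF_def prod.case c using \<open>0 < \<alpha>\<close> by simp
  qed
  \<comment> \<open>\<open>?E\<close> is also the integral of the tangent along every admissible
    state.\<close>
  have energy_c: "energy \<alpha> q \<Omega> (\<lambda>x. ?c) = ereal ?E"
    unfolding energy_def Hc by (subst ext_integral_integrable) (simp_all add: meas)
  have q: "q < - n + sqrt (n\<^sup>2 + \<alpha> * m\<^sup>2)"
    using assms by simp
  have le: "H_TF_tangent \<alpha> q n m v \<le> H_TF \<alpha> q v" for v
    using H_TF_tangent_le_and_eq[OF \<open>0 < \<alpha>\<close> n q] by (cases v) auto
  note tangent = admissible_tangent[OF lm pos assms(5,6)]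
  have "global_minimizer \<alpha> q \<Omega> N M (\<lambda>x. ?c)"
    unfolding global_minimizer_def energy_c
  proof (intro conjI adm allI impI)
    fix v assume v: "admissible \<Omega> N M v"
    show "ereal ?E \<le> energy \<alpha> q \<Omega> v"
      using ext_integral_ge[OF tangent(1)[OF v] tangent(2)[OF v] le]
      unfolding energy_def tangent(3)[OF v] .
  qed
  moreover have "AE x in ?L. u x = ?c" if u: "global_minimizer \<alpha> q \<Omega> N M u" for u
  proof -
    have v: "admissible \<Omega> N M u" and "energy \<alpha> q \<Omega> u \<le> ereal ?E"
      using u adm energy_c unfolding global_minimizer_def by metis+
    \<comment> \<open>The energy of a minimizer is at most the integral of its own tangent minorant,
      so the two integrands agree almost everywhere.\<close>
    then have "AE x in ?L. H_TF_tangent \<alpha> q n m (u x) = H_TF \<alpha> q (u x)"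
      by (intro ext_integral_le_imp_AE_eq tangent le) (simp_all add: energy_def tangent)
    then show ?thesis
      using tangent(4)[OF v]
    proof eventually_elim
      case (elim x)
      obtain a b c where abc: "u x = (a, b, c)"
        by (cases "u x")
      then have "b = 0" "a\<^sup>2 + c\<^sup>2 = n" "a\<^sup>2 - c\<^sup>2 = m"
        using H_TF_tangent_le_and_eq[OF \<open>0 < \<alpha>\<close> n q] elim by metis+
      \<comment> \<open>Contact fixes only the squares of \<open>a\<close> and \<open>c\<close>;
        almost everywhere nonnegativity selects the roots.\<close>
      then have "(n + m) / 2 = a\<^sup>2" "(n - m) / 2 = c\<^sup>2"
        by (simp_all add: field_simps)
      then have "sqrt ((n + m) / 2) = a" "sqrt ((n - m) / 2) = c"
        using elim abc by simp_all
      then show ?case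
        using abc \<open>b = 0\<close> by simp
    qed
  qed
  ultimately show ?thesis
    by blast
qed

end
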